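(* For each $\tau\in\{\tau_1,\gamma,\lambda,\rho\}$: (i) $\tau$ is the kernel of the homomorphism $r_\tau:\mathfrak A^*\to\mathcal R_\tau$ given by $\mathbf u\mapsto r_\tau(\mathbf u)$; (ii) the homomorphism $r_\tau:\mathfrak A^*\to\mathcal R_\tau$ induces the isomorphism $r_\tau$ from $\langle\mathfrak A^*/\tau,\circ_\tau\rangle$ onto $\langle\mathcal R_\tau,\diamond_\tau\rangle$ defined by $r_\tau(\mathtt u)=r_\tau(\mathbf u)$ for each $\mathtt u\in\mathfrak A^*/\tau$ and $\mathbf u\in\mathtt u$.
   Context: Let $\mathfrak A$ be a countably infinite alphabet and $\mathfrak A^*$ the free monoid over it. A letter is multiple in a word if it occurs at least twice in it; $\operatorname{mul}(\mathbf u)$ is the set of multiple letters of $\mathbf u$. Let $\tau_1$ be the congruence on $\mathfrak A^*$ generated by $a=a^2$, $a\in\mathfrak A$. For $\mathbf u,\mathbf v\in\mathfrak A^*$: $\mathbf u\,\gamma\,\mathbf v$ iff $\mathbf u\,\tau_1\,\mathbf v$ and $\operatorname{mul}(\mathbf u)=\operatorname{mul}(\mathbf v)$; $\mathbf u\,\lambda\,\mathbf v$ (resp. $\mathbf u\,\rho\,\mathbf v$) iff $\mathbf u\,\gamma\,\mathbf v$ and, for each multiple letter, its first (resp. last) two occurrences are adjacent in $\mathbf u$ iff they are adjacent in $\mathbf v$. For a congruence $\tau$, $\circ_\tau$ denotes the operation of $\mathfrak A^*/\tau$. Let $\mathfrak B=\{a^+\mid a\in\mathfrak A\}$ be a formal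 alphabet of new symbols, disjoint from $\mathfrak A$. Consider the following rewriting rules on words $\mathbf u\in(\mathfrak A\cup\mathfrak B)^*$, for each $a\in\mathfrak A$: $R^{\tau_1}_{a\to a^+}$ replaces an occurrence of $a$ in $\mathbf u$ by $a^+$; $R^{\gamma}_{a\to a^+}$ replaces an occurrence of $a$ in $\mathbf u$ by $a^+$ only if $\mathbf u$ contains either another occurrence of $a$ or an occurrence of $a^+$; $R^{\lambda}_{a\to a^+}$ (resp. $R^{\rho}_{a\to a^+}$) replaces an occurrence of $a$ in $\mathbf u$ by $a^+$ only if $a$ or $a^+$ appears in $\mathbf u$ to the left (resp. right) of this occurrence of $a$; $R_{a^+a^+\to a^+}$, $R_{aa^+\to a^+}$, $R_{a^+a\to a^+}$ replace a factor $a^+a^+$, $aa^+$, $a^+a$, respectively, by $a^+$. For $\tau\in\{\tau_1,\gamma,\lambda,\rho\}$ let $R_\tau=\{R^\tau_{a\to a^+},R_{a^+a^+\to a^+},R_{aa^+\to a^+},R_{a^+a\to a^+}\mid a\in\mathfrak A\}$. Every word $\mathbf u\in(\mathfrak A\cup\mathfrak B)^*$ can be transformed by the rules $R_\tau$, in any order, to a unique word $r_\tau(\mathbf u)$ to which no rule of $R_\tau$ is applicable. Let $\mathcal R_\tau$ be the set of all words of $(\mathfrak A\cup\mathfrak B)^*$ to which no rule of $R_\tau$ is applicable, with the operation $\mathbf u\diamond_\tau\mathbf v=r_\tau(\mathbf{uv})$, where $\mathbf{uv}$ is concatenation in $(\mathfrak A\cup\mathfrak B)^*$. *)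

theory Defs
  imports "HOL-Algebra.Group" "HOL-Library.Countable_Set"
begin

definition mul :: "'a list \<Rightarrow> 'a set" where
  "mul u = {a. count_list u a \<ge> 2}"

definition word_congruence :: "('a list \<times> 'a list) set \<Rightarrow> bool" where
  "word_congruence T \<longleftrightarrow> equiv UNIV T \<and>
     (\<forall>u v w. (u, v) \<in> T \<longrightarrow> (w @ u, w @ v) \<in> T \<and> (u @ w, v @ w) \<in> T)"

definition tau1 :: "('a list \<times> 'a list) set" where
  "tau1 = \<Inter> {T. word_congruence T \<and> (\<forall>a. ([a], [a, a]) \<in> T)}"

definition gamma :: "('a list \<times> 'a list) set" where
  "gamma = {(u, v). (u, v) \<in> tau1 \<and> mul u = mul v}"

definition first_two_adjacent :: "'a \<Rightarrow> 'a list \<Rightarrow> bool" where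
  "first_two_adjacent a u \<longleftrightarrow> (\<exists>xs ys. u = xs @ [a, a] @ ys \<and> a \<notin> set xs)"

definition last_two_adjacent :: "'a \<Rightarrow> 'a list \<Rightarrow> bool" where
  "last_two_adjacent a u \<longleftrightarrow> (\<exists>xs ys. u = xs @ [a, a] @ ys \<and> a \<notin> set ys)"

text \<open>The quantifier ranges over the letters multiple in \<open>u\<close>, which are
  those multiple in \<open>v\<close> because \<open>u\<close> and \<open>v\<close> are \<open>gamma\<close>-related.\<close>

definition lambda :: "('a list \<times> 'a list) set" where
  "lambda = {(u, v). (u, v) \<in> gamma \<and>
     (\<forall>a\<in>mul u. first_two_adjacent a u \<longleftrightarrow> first_two_adjacent a v)}"

definition rho :: "('a list \<times> 'a list) set" where
  "rho = {(u, v). (u, v) \<in> gamma \<and>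
     (\<forall>a\<in>mul u. last_two_adjacent a u \<longleftrightarrow> last_two_adjacent a v)}"

datatype cong_name = Tau1 | Gamma | Lambda | Rho

fun cong_rel :: "cong_name \<Rightarrow> ('a list \<times> 'a list) set" where
  "cong_rel Tau1 = tau1"
| "cong_rel Gamma = gamma"
| "cong_rel Lambda = lambda"
| "cong_rel Rho = rho"

text \<open>The disjoint union of the alphabet with the alphabet of new symbols:
  \<open>Plus a\<close> is the symbol \<open>a\<^sup>+\<close>.\<close>

datatype 'a sym = Letter 'a | Plus 'a

text \<open>Side condition for replacing, in \<open>xs @ [Letter a] @ ys\<close>, the displayed
  occurrence of \<open>Letter a\<close> by \<open>Plus a\<close>.\<close>

fun plus_cond :: "cong_name \<Rightarrow> 'a sym list \<Rightarrow> 'a \<Rightarrow> 'a sym list \<Rightarrow> bool" where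
  "plus_cond Tau1 xs a ys \<longleftrightarrow> True"
| "plus_cond Gamma xs a ys \<longleftrightarrow> Letter a \<in> set xs \<union> set ys \<or> Plus a \<in> set xs \<union> set ys"
| "plus_cond Lambda xs a ys \<longleftrightarrow> Letter a \<in> set xs \<or> Plus a \<in> set xs"
| "plus_cond Rho xs a ys \<longleftrightarrow> Letter a \<in> set ys \<or> Plus a \<in> set ys"

inductive step :: "cong_name \<Rightarrow> 'a sym list \<Rightarrow> 'a sym list \<Rightarrow> bool" for t where
  letter: "plus_cond t xs a ys \<Longrightarrow> step t (xs @ [Letter a] @ ys) (xs @ [Plus a] @ ys)"
| plus_plus: "step t (xs @ [Plus a, Plus a] @ ys) (xs @ [Plus a] @ ys)"
| letter_plus: "step t (xs @ [Letter a, Plus a] @ ys) (xs @ [Plus a] @ ys)"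
| plus_letter: "step t (xs @ [Plus a, Letter a] @ ys) (xs @ [Plus a] @ ys)"

definition reduced :: "cong_name \<Rightarrow> 'a sym list \<Rightarrow> bool" where
  "reduced t u \<longleftrightarrow> (\<nexists>v. step t u v)"

text \<open>Rewriting is terminating and confluent, so the description denotes the
  unique reduced word that can be reached from \<open>u\<close>.\<close>

definition normal_form :: "cong_name \<Rightarrow> 'a sym list \<Rightarrow> 'a sym list" where
  "normal_form t u = (THE v. (step t)\<^sup>*\<^sup>* u v \<and> reduced t v)"

definition r :: "cong_name \<Rightarrow> 'a list \<Rightarrow> 'a sym list" where
  "r t u = normal_form t (map Letter u)"

definition free_monoid :: "'a list monoid" where
  "free_monoid = \<lparr>carrier = UNIV, mult = (@), one = []\<rparr>"

text \<open>When \<open>T\<close> is a congruence of \<open>M\<close>, the product of two classes is the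
  class of the product of any two of their representatives.\<close>

definition quotient_monoid :: "'b monoid \<Rightarrow> ('b \<times> 'b) set \<Rightarrow> 'b set monoid" where
  "quotient_monoid M T =
     \<lparr>carrier = carrier M // T,
      mult = (\<lambda>X Y. \<Union>x\<in>X. \<Union>y\<in>Y. T `` {x \<otimes>\<^bsub>M\<^esub> y}),
      one = T `` {\<one>\<^bsub>M\<^esub>}\<rparr>"

definition reduced_monoid :: "cong_name \<Rightarrow> 'a sym list monoid" where
  "reduced_monoid t =
     \<lparr>carrier = {u. reduced t u}, mult = (\<lambda>u v. normal_form t (u @ v)), one = []\<rparr>"

end

(* The word of underlying letters with adjacent repetitions removed, together with the set of
   letters a having an occurrence that survives as a (not as a^+) in the normal form, is invariant
   under every rewriting step and determines a reduced word. Since rewriting terminates, this yields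
   uniqueness of normal forms without a confluence argument, and r_tau u = r_tau v reduces to
   comparing the invariants of u and v. The case rho is the mirror image of lambda.
   Surjectivity holds because aa rewrites to a^+. *)
theory Submission
  imports Defs
begin

section \<open>Projection to underlying letters, rewriting in context, termination\<close>

primrec letter_of :: "'a sym \<Rightarrow> 'a" where
  "letter_of (Letter a) = a"
| "letter_of (Plus a) = a"

lemma Letter_or_Plus_mem_iff:
  "Letter a \<in> set xs \<or> Plus a \<in> set xs \<longleftrightarrow> a \<in> letter_of ` set xs"
proof
  assume "a \<in> letter_of ` set xs"
  then obtain x where "x \<in> set xs" "a = letter_of x" by auto
  then show "Letter a \<in> set xs \<or> Plus a \<in> set xs" by - (cases x; simp)
qed force

text \<open>Side conditions read only the underlying letters of the context, so they agree at equal
  positions of two words with the same projection; \<open>reduced_eqI\<close> rests on this.\<close>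

lemma plus_cond_letter_of:
  "plus_cond t xs a ys \<longleftrightarrow> (case t of Tau1 \<Rightarrow> True
     | Gamma \<Rightarrow> a \<in> letter_of ` set xs \<or> a \<in> letter_of ` set ys
     | Lambda \<Rightarrow> a \<in> letter_of ` set xs | Rho \<Rightarrow> a \<in> letter_of ` set ys)"
  using Letter_or_Plus_mem_iff[of a xs] Letter_or_Plus_mem_iff[of a ys] by (cases t) auto

lemma plus_cond_append: "plus_cond t xs a ys \<Longrightarrow> plus_cond t (us @ xs) a (ys @ vs)"
  by (cases t) auto

lemma step_append:
  assumes "step t u v"
  shows "step t (xs @ u @ ys) (xs @ v @ ys)"
  using assms
proof cases
  case (letter us a vs)
  then show ?thesis
    using step.letter[OF plus_cond_append[of t us a vs xs ys]] by simp
next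
  case (plus_plus us a vs)
  then show ?thesis using step.plus_plus[of t "xs @ us" a "vs @ ys"] by simp
next
  case (letter_plus us a vs)
  then show ?thesis using step.letter_plus[of t "xs @ us" a "vs @ ys"] by simp
next
  case (plus_letter us a vs)
  then show ?thesis using step.plus_letter[of t "xs @ us" a "vs @ ys"] by simp
qed

lemma steps_append:
  "(step t)\<^sup>*\<^sup>* u v \<Longrightarrow> (step t)\<^sup>*\<^sup>* (xs @ u @ ys) (xs @ v @ ys)"
  by (induction rule: rtranclp_induct) (auto intro: rtranclp.rtrancl_into_rtrancl step_append)

lemma steps_append2:
  assumes "(step t)\<^sup>*\<^sup>* u u'" "(step t)\<^sup>*\<^sup>* v v'"
  shows "(step t)\<^sup>*\<^sup>* (u @ v) (u' @ v')"
  using steps_append[OF assms(1), of "[]" v] steps_append[OF assms(2), of u' "[]"] by simp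

lemma steps_to_reduced: "\<exists>v. (step t)\<^sup>*\<^sup>* u v \<and> reduced t v"
\<comment> \<open>The measure is length plus number of plain letters: starring a letter lowers the
  second summand and keeps the length, while the collapsing rules shorten the word without adding
  plain letters.\<close>
proof (induction "length u + length (filter (\<lambda>x. x = Letter (letter_of x)) u)"
    arbitrary: u rule: less_induct)
  case less
  show ?case
  proof (cases "reduced t u")
    case False
    then obtain v where v: "step t u v" by (auto simp: reduced_def)
    then have "length v + length (filter (\<lambda>x. x = Letter (letter_of x)) v)
        < length u + length (filter (\<lambda>x. x = Letter (letter_of x)) u)"
      by cases auto
    from less[OF this] v show ?thesis by (meson converse_rtranclp_into_rtranclp)
  qed blast
qed

section \<open>Mirror symmetry and the invariants of rewriting\<close>

lemma step_rev: "step Rho u v \<Longrightarrow> step Lambda (rev u) (rev v)"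
proof (induction rule: step.induct)
  case (letter xs a ys)
  then show ?case using step.letter[of Lambda "rev ys" a "rev xs"] by simp
next
  case (plus_plus xs a ys)
  then show ?case using step.plus_plus[of Lambda "rev ys" a "rev xs"] by simp
next
  case (letter_plus xs a ys)
  then show ?case using step.plus_letter[of Lambda "rev ys" a "rev xs"] by simp
next
  case (plus_letter xs a ys)
  then show ?case using step.letter_plus[of Lambda "rev ys" a "rev xs"] by simp
qed

text \<open>The leftmost maximal block of symbols over \<open>a\<close> is a lone plain
  \<open>Letter a\<close>; \<open>dropWhile\<close> moves to the start of that block.\<close>

definition light_first :: "'a sym list \<Rightarrow> 'a \<Rightarrow> bool" where
  "light_first w a \<longleftrightarrow>
     (\<exists>zs. dropWhile (\<lambda>x. letter_of x \<noteq> a) w = Letter a # zs \<and>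
           (zs = [] \<or> letter_of (hd zs) \<noteq> a))"

text \<open>The letters \<open>a\<close> that still occur as \<open>Letter a\<close> in the normal form of \<open>w\<close>.\<close>

fun light :: "cong_name \<Rightarrow> 'a sym list \<Rightarrow> 'a \<Rightarrow> bool" where
  "light Tau1 w a \<longleftrightarrow> False"
| "light Gamma w a \<longleftrightarrow> filter (\<lambda>x. letter_of x = a) w = [Letter a]"
| "light Lambda w a \<longleftrightarrow> light_first w a"
| "light Rho w a \<longleftrightarrow> light_first (rev w) a"

lemma dropWhile_letter_of_append:
  "dropWhile (\<lambda>x. letter_of x \<noteq> a) (xs @ ys) =
     (if a \<in> letter_of ` set xs then dropWhile (\<lambda>x. letter_of x \<noteq> a) xs @ ys
      else dropWhile (\<lambda>x. letter_of x \<noteq> a) ys)"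
  by (induction xs) auto

text \<open>The test inspects only the first symbol over \<open>b\<close>, which lies in
  \<open>xs\<close>, and the letter under its successor, which lies in \<open>xs\<close> or is
  \<open>y\<close> (resp. \<open>z\<close>); the tails are never reached.\<close>

lemma light_first_append_cong:
  assumes "b \<in> letter_of ` set xs" "letter_of y = letter_of z"
  shows "light_first (xs @ y # ys) b \<longleftrightarrow> light_first (xs @ z # zs) b"
proof -
  have "dropWhile (\<lambda>x. letter_of x \<noteq> b) xs \<noteq> []"
    using assms(1) by auto
  then obtain x us where "dropWhile (\<lambda>x. letter_of x \<noteq> b) xs = x # us"
    by (meson neq_Nil_conv)
  then show ?thesis
    using assms by (cases us) (auto simp: light_first_def dropWhile_letter_of_append)
qed

lemma light_first_step:
  assumes "step Lambda u v"
  shows "light_first u b \<longleftrightarrow> light_first v b"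
proof -
  have new: "light_first (xs @ ys) b \<longleftrightarrow> light_first ys b" if "b \<notin> letter_of ` set xs" for xs ys
    using that by (simp add: light_first_def dropWhile_letter_of_append)
  from assms show ?thesis
  proof cases
    case (letter xs a ys)
    \<comment> \<open>The side condition puts a symbol over \<open>a\<close> into \<open>xs\<close>;
      so if \<open>b\<close> does not occur over \<open>xs\<close>, then \<open>a\<close> and
      \<open>b\<close> differ and the replaced symbol is skipped.\<close>
    then have "a \<in> letter_of ` set xs" by (simp add: plus_cond_letter_of)
    with letter show ?thesis
      using light_first_append_cong[of b xs "Letter a" "Plus a" ys ys]
      by (cases "b \<in> letter_of ` set xs"; cases "a = b") (simp_all add: new, simp add: light_first_def)
  next
    case (plus_plus xs a ys)
    then show ?thesis
      using light_first_append_cong[of b xs "Plus a" "Plus a" "Plus a # ys" ys]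
      by (cases "b \<in> letter_of ` set xs") (simp_all add: new, simp add: light_first_def)
  next
    case (letter_plus xs a ys)
    then show ?thesis
      using light_first_append_cong[of b xs "Letter a" "Plus a" "Plus a # ys" ys]
      by (cases "b \<in> letter_of ` set xs") (simp_all add: new, simp add: light_first_def)
  next
    case (plus_letter xs a ys)
    then show ?thesis
      using light_first_append_cong[of b xs "Plus a" "Plus a" "Letter a # ys" ys]
      by (cases "b \<in> letter_of ` set xs") (simp_all add: new, simp add: light_first_def)
  qed
qed

lemma light_Gamma_step:
  assumes "step Gamma u v"
  shows "light Gamma u b \<longleftrightarrow> light Gamma v b"
  using assms
proof cases
  case (letter xs a ys)
  \<comment> \<open>A second symbol over \<open>a\<close> exists, so for \<open>b = a\<close>
    neither filtered word is \<open>[Letter a]\<close>.\<close>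
  then have "filter (\<lambda>x. letter_of x = a) (xs @ ys) \<noteq> []"
    by (auto simp: plus_cond_letter_of filter_empty_conv)
  with letter show ?thesis
    by (auto simp: append_eq_Cons_conv)
qed (auto simp: append_eq_Cons_conv)

lemma light_step:
  assumes "step t u v"
  shows "light t u = light t v"
proof
  show "light t u b = light t v b" for b
    using assms light_Gamma_step[of u v b] light_first_step[of u v b]
      light_first_step[of "rev u" "rev v" b] step_rev[of u v]
    by - (cases t; simp del: light.simps(2))
qed

lemma remdups_adj_append_Cons_Cons:
  "remdups_adj (xs @ a # a # ys) = remdups_adj (xs @ a # ys)"
  by (induction xs rule: remdups_adj.induct) auto

lemma remdups_adj_step:
  "step t u v \<Longrightarrow> remdups_adj (map letter_of u) = remdups_adj (map letter_of v)"
  by (induction rule: step.induct) (simp_all add: remdups_adj_append_Cons_Cons)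

lemma steps_invariant:
  "(step t)\<^sup>*\<^sup>* u v \<Longrightarrow>
     remdups_adj (map letter_of u) = remdups_adj (map letter_of v) \<and> light t u = light t v"
  by (induction rule: rtranclp_induct) (simp_all add: remdups_adj_step light_step)

lemma reduced_distinct_adj:
  assumes "reduced t w"
  shows "distinct_adj (map letter_of w)"
proof (rule ccontr)
  assume "\<not> distinct_adj (map letter_of w)"
  then obtain i where i: "Suc i < length w" "letter_of (w ! i) = letter_of (w ! Suc i)"
    by (auto simp: distinct_adj_conv_nth)
  define xs where "xs = take i w"
  define ys where "ys = drop (Suc (Suc i)) w"
  have w: "w = xs @ [w ! i, w ! Suc i] @ ys"
    using i id_take_nth_drop[of i w] Cons_nth_drop_Suc[of "Suc i" w] by (simp add: xs_def ys_def)
  define a where "a = letter_of (w ! i)"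
  have x: "w ! i = Letter a \<or> w ! i = Plus a" and y: "w ! Suc i = Letter a \<or> w ! Suc i = Plus a"
    using i(2) by (cases "w ! i"; cases "w ! Suc i"; simp add: a_def)+
  \<comment> \<open>The only pair with a side condition: each letter is a witness for its neighbour.
    For \<open>Rho\<close> the left letter is starred, since the witness must lie to the right;
    otherwise the right one.\<close>
  have LL: "\<exists>v. step t (xs @ [Letter a, Letter a] @ ys) v"
  proof (cases t)
    case Rho
    then show ?thesis using step.letter[of t xs a "Letter a # ys"] by auto
  qed (use step.letter[of t "xs @ [Letter a]" a ys] in auto)
  have "\<exists>v. step t (xs @ [w ! i, w ! Suc i] @ ys) v"
    using x y LL step.plus_plus[of t xs a ys] step.letter_plus[of t xs a ys]
      step.plus_letter[of t xs a ys] by fastforce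
  with w assms show False unfolding reduced_def by metis
qed

text \<open>Failure of the side condition makes \<open>x\<close> the only, first or last symbol over
  its letter (for \<open>Gamma\<close>, \<open>Lambda\<close>, \<open>Rho\<close>); without equal
  neighbours its block is a singleton, so \<open>light\<close> reads \<open>x\<close> itself. For
  \<open>Tau1\<close> failure is impossible.\<close>

lemma light_of_not_plus_cond:
  assumes "distinct_adj (map letter_of (xs @ x # ys))" "\<not> plus_cond t xs (letter_of x) ys"
  shows "light t (xs @ x # ys) (letter_of x) \<longleftrightarrow> x = Letter (letter_of x)"
proof (cases t)
  case Tau1
  then show ?thesis using assms by simp
next
  case Gamma
  then have "filter (\<lambda>z. letter_of z = letter_of x) xs = []"
    "filter (\<lambda>z. letter_of z = letter_of x) ys = []"
    using assms(2) by (auto simp: plus_cond_letter_of filter_empty_conv image_iff)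
  with Gamma show ?thesis by simp
next
  case Lambda
  then show ?thesis using assms
    by (cases ys) (auto simp: plus_cond_letter_of light_first_def dropWhile_letter_of_append distinct_adj_append_iff)
next
  case Rho
  then show ?thesis using assms
    by (cases xs rule: rev_cases)
       (auto simp: plus_cond_letter_of light_first_def dropWhile_letter_of_append distinct_adj_append_iff)
qed

text \<open>Describes each symbol of a reduced word by data depending on the invariants alone:
  \<open>light\<close> and, through the projection, the side condition. A plain letter meeting the
  side condition could still be rewritten.\<close>

lemma reduced_Letter_iff:
  assumes "reduced t w" "w = xs @ x # ys"
  shows "x = Letter (letter_of x) \<longleftrightarrow>
     light t w (letter_of x) \<and> \<not> plus_cond t xs (letter_of x) ys"
proof (cases "plus_cond t xs (letter_of x) ys")
  case True
  then have "x \<noteq> Letter (letter_of x)"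
    using step.letter[of t xs "letter_of x" ys] assms by (auto simp: reduced_def)
  with True show ?thesis by simp
next
  case False
  with light_of_not_plus_cond[of xs x ys t] reduced_distinct_adj[OF assms(1)] assms(2)
  show ?thesis by simp
qed

lemma reduced_eqI:
  assumes "reduced t u" "reduced t v"
    and "remdups_adj (map letter_of u) = remdups_adj (map letter_of v)"
    and "light t u = light t v"
  shows "u = v"
proof (rule nth_equalityI)
  \<comment> \<open>Both projections have no equal neighbours, so \<open>remdups_adj\<close> fixes
    them.\<close>
  have m: "map letter_of u = map letter_of v"
    using assms(3) reduced_distinct_adj[OF assms(1)] reduced_distinct_adj[OF assms(2)]
    by (simp add: distinct_adj_altdef)
  then show len: "length u = length v" by (rule map_eq_imp_length_eq)
  fix i assume i: "i < length u"
  have l: "letter_of (u ! i) = letter_of (v ! i)"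
    using m i len by (metis nth_map)
  have s: "letter_of ` set (take i u) = letter_of ` set (take i v)"
    "letter_of ` set (drop (Suc i) u) = letter_of ` set (drop (Suc i) v)"
    using m by (metis set_map take_map, metis set_map drop_map)
  have "plus_cond t (take i u) a (drop (Suc i) u) \<longleftrightarrow> plus_cond t (take i v) a (drop (Suc i) v)" for a
    by (simp only: plus_cond_letter_of s)
  then have "u ! i = Letter (letter_of (u ! i)) \<longleftrightarrow> v ! i = Letter (letter_of (v ! i))"
    using reduced_Letter_iff[OF assms(1) id_take_nth_drop[OF i]]
      reduced_Letter_iff[OF assms(2) id_take_nth_drop[of i v]] i len l assms(4)
    by simp
  with l show "u ! i = v ! i"
    by (cases "u ! i"; cases "v ! i") auto
qed

section \<open>Uniqueness of normal forms and the homomorphism property\<close>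

lemma normal_form_eqI:
  assumes "(step t)\<^sup>*\<^sup>* u v" "reduced t v"
  shows "normal_form t u = v"
  unfolding normal_form_def
proof (rule the_equality)
  fix w assume "(step t)\<^sup>*\<^sup>* u w \<and> reduced t w"
  \<comment> \<open>Both \<open>v\<close> and \<open>w\<close> carry the invariants of
    \<open>u\<close>, hence coincide.\<close>
  then show "w = v"
    using reduced_eqI assms steps_invariant[of t u v] steps_invariant[of t u w] by metis
qed (use assms in simp)

lemma steps_normal_form: "(step t)\<^sup>*\<^sup>* u (normal_form t u)"
  and reduced_normal_form: "reduced t (normal_form t u)"
  using steps_to_reduced[of t u] normal_form_eqI by metis+

lemma normal_form_eq_iff:
  "normal_form t u = normal_form t v \<longleftrightarrow>
     remdups_adj (map letter_of u) = remdups_adj (map letter_of v) \<and> light t u = light t v"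
  using steps_invariant[OF steps_normal_form] reduced_eqI[OF reduced_normal_form reduced_normal_form]
  by metis

text \<open>Normalising both factors and then their product is one way of rewriting
  \<open>u @ v\<close>, and it ends in a reduced word.\<close>

lemma normal_form_append:
  "normal_form t (normal_form t u @ normal_form t v) = normal_form t (u @ v)"
proof (rule sym, rule normal_form_eqI[OF _ reduced_normal_form])
  show "(step t)\<^sup>*\<^sup>* (u @ v) (normal_form t (normal_form t u @ normal_form t v))"
    by (rule rtranclp_trans[OF steps_append2[OF steps_normal_form steps_normal_form] steps_normal_form])
qed

lemma r_append: "r t (u @ v) = normal_form t (r t u @ r t v)"
  by (simp add: r_def normal_form_append)

lemma reduced_Nil: "reduced t []"
  by (auto simp: reduced_def elim: step.cases)

lemma r_Nil: "r t [] = []"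
  by (simp add: r_def normal_form_eqI reduced_Nil)

section \<open>Surjectivity onto the reduced words\<close>

lemma steps_Letter_Letter: "(step t)\<^sup>*\<^sup>* [Letter a, Letter a] [Plus a]"
proof (cases t)
  case Rho
  then have "step t [Letter a, Letter a] [Plus a, Letter a]"
    using step.letter[of t "[]" a "[Letter a]"] by simp
  then show ?thesis
    using step.plus_letter[of t "[]" a "[]"] by (simp add: converse_rtranclp_into_rtranclp)
qed (use step.letter[of t "[Letter a]" a "[]"] step.letter_plus[of t "[]" a "[]"]
      in \<open>simp add: converse_rtranclp_into_rtranclp\<close>)+

text \<open>Write \<open>aa\<close> for each \<open>Plus a\<close>. For a reduced \<open>w\<close>
  this exhibits \<open>w\<close> as the normal form of a plain word.\<close>

lemma steps_from_letters: "\<exists>u. (step t)\<^sup>*\<^sup>* (map Letter u) w"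
proof (induction w)
  case (Cons x w)
  then obtain u where u: "(step t)\<^sup>*\<^sup>* (map Letter u) w" by blast
  obtain v where "(step t)\<^sup>*\<^sup>* (map Letter v) [x]"
  proof (cases x)
    case (Letter a)
    then show ?thesis using that[of "[a]"] by simp
  next
    case (Plus a)
    then show ?thesis using that[of "[a, a]"] steps_Letter_Letter[of t a] by simp
  qed
  from steps_append2[OF this u] show ?case
    by (metis append_Cons append_Nil map_append)
qed (auto intro: exI[of _ "[]"])

lemma range_r: "range (r t) = {w. reduced t w}"
proof
  show "range (r t) \<subseteq> {w. reduced t w}" by (auto simp: r_def reduced_normal_form)
  show "{w. reduced t w} \<subseteq> range (r t)"
    using steps_from_letters normal_form_eqI unfolding r_def by fastforce
qed

section \<open>The congruence \<open>tau1\<close> as the kernel of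
  \<open>remdups_adj\<close>\<close>

lemma remdups_adj_append_cong:
  assumes "remdups_adj u = remdups_adj v"
  shows "remdups_adj (w @ u) = remdups_adj (w @ v)"
proof (induction w rule: remdups_adj.induct)
  case (2 x)
  \<comment> \<open>Prepending a letter looks at \<open>u\<close> only through
    \<open>remdups_adj u\<close>.\<close>
  have "remdups_adj (x # u) = (case remdups_adj u of [] \<Rightarrow> [x]
      | y # ys \<Rightarrow> if x = y then y # ys else x # y # ys)" for u
    by (simp add: remdups_adj_Cons)
  then show ?case using assms by simp
qed (use assms in auto)

lemma word_congruence_remdups_adj:
  "word_congruence {(u, v). remdups_adj u = remdups_adj v}"
proof -
  have "remdups_adj (u @ w) = remdups_adj (v @ w)" if "remdups_adj u = remdups_adj v"
    for u v w :: "'a list"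
    \<comment> \<open>Right compatibility is left compatibility read backwards, as
      \<open>remdups_adj\<close> commutes with \<open>rev\<close>.\<close>
    using remdups_adj_append_cong[of "rev u" "rev v" "rev w"] that
    by (simp flip: rev_append)
  moreover have "equiv UNIV {(u, v). remdups_adj u = remdups_adj v}"
    by (auto simp: equiv_def refl_on_def sym_def trans_def)
  ultimately show ?thesis
    unfolding word_congruence_def using remdups_adj_append_cong by blast
qed

text \<open>The kernel of \<open>remdups_adj\<close> is a congruence containing the generators, so
  it contains \<open>tau1\<close>; conversely every such congruence relates each word to its
  \<open>remdups_adj\<close>.\<close>

lemma tau1_eq: "tau1 = {(u :: 'a list, v). remdups_adj u = remdups_adj v}"
proof
  show "tau1 \<subseteq> {(u :: 'a list, v). remdups_adj u = remdups_adj v}"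
    unfolding tau1_def using word_congruence_remdups_adj by (intro Inter_lower) auto
next
  show "{(u :: 'a list, v). remdups_adj u = remdups_adj v} \<subseteq> tau1"
    unfolding tau1_def
  proof (rule Inter_greatest)
    fix T :: "('a list \<times> 'a list) set"
    assume "T \<in> {T. word_congruence T \<and> (\<forall>a. ([a], [a, a]) \<in> T)}"
    then have T: "equiv UNIV T" and gen: "([a], [a, a]) \<in> T"
      and app: "(u, v) \<in> T \<Longrightarrow> (w @ u, w @ v) \<in> T \<and> (u @ w, v @ w) \<in> T" for a u v w
      by (auto simp: word_congruence_def)
    have refl: "(u, u) \<in> T" for u using T by (auto simp: equiv_def refl_on_def)
    have sym: "(v, u) \<in> T" if "(u, v) \<in> T" for u v using T that by (auto simp: equiv_def sym_def)
    have trans: "(u, w) \<in> T" if "(u, v) \<in> T" "(v, w) \<in> T" for u v w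
      using T that by (auto simp: equiv_def trans_def)
    have nf: "(u, remdups_adj u) \<in> T" for u
    proof (induction u rule: remdups_adj.induct)
      case (3 x y xs)
      show ?case
      proof (cases "x = y")
        case True
        then have "(x # y # xs, x # xs) \<in> T" using app[OF sym[OF gen[of x]], of xs] by simp
        with 3 True show ?thesis by (auto intro: trans)
      next
        case False
        with 3 app[of "y # xs" "remdups_adj (y # xs)" "[x]"] show ?thesis by simp
      qed
    qed (simp_all add: refl)
    show "{(u, v). remdups_adj u = remdups_adj v} \<subseteq> T"
    proof (rule subrelI)
      fix u v :: "'a list"
      assume "(u, v) \<in> {(u, v). remdups_adj u = remdups_adj v}"
      then have "(remdups_adj u, v) \<in> T" using sym[OF nf[of v]] by simp
      then show "(u, v) \<in> T" by (rule trans[OF nf])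
    qed
  qed
qed

section \<open>Multiplicity and adjacency read off the invariants of plain words\<close>

lemma mul_rev: "mul (rev u) = mul u"
  by (simp add: mul_def)

text \<open>The symbols over \<open>a\<close> form \<open>count_list u a\<close> copies of
  \<open>Letter a\<close>, so \<open>light\<close> means exactly one occurrence.\<close>

lemma light_Gamma_map_Letter:
  "light Gamma (map Letter u) a \<longleftrightarrow> a \<in> set u \<and> a \<notin> mul u"
proof -
  have "filter (\<lambda>x. letter_of x = a) (map Letter u) = replicate (count_list u a) (Letter a)"
    by (induction u) auto
  then have "light Gamma (map Letter u) a \<longleftrightarrow> count_list u a = 1"
    by (cases "count_list u a") simp_all
  moreover have "a \<in> set u \<longleftrightarrow> count_list u a \<noteq> 0"
    by (simp add: count_list_0_iff)
  ultimately show ?thesis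
    unfolding mul_def mem_Collect_eq by linarith
qed

text \<open>Once the word is split at the first \<open>a\<close>, both sides are decided by what
  comes right after it.\<close>

lemma light_first_map_Letter:
  "light_first (map Letter u) a \<longleftrightarrow> a \<in> set u \<and> \<not> first_two_adjacent a u"
proof (cases "a \<in> set u")
  case True
  then obtain xs ys where u: "u = xs @ a # ys" "a \<notin> set xs"
    by (meson split_list_first)
  then have "light_first (map Letter u) a \<longleftrightarrow> ys = [] \<or> hd ys \<noteq> a"
    by (cases ys) (auto simp: light_first_def dropWhile_letter_of_append)
  moreover have "first_two_adjacent a u \<longleftrightarrow> ys \<noteq> [] \<and> hd ys = a"
  proof
    assume "first_two_adjacent a u"
    then obtain xs' ys' where "u = xs' @ a # a # ys'" "a \<notin> set xs'"
      by (auto simp: first_two_adjacent_def)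
    with u have "ys = a # ys'"
      by (auto simp: append_eq_append_conv2 append_eq_Cons_conv Cons_eq_append_conv)
    then show "ys \<noteq> [] \<and> hd ys = a" by simp
  next
    assume "ys \<noteq> [] \<and> hd ys = a"
    with u show "first_two_adjacent a u"
      unfolding first_two_adjacent_def by (cases ys) auto
  qed
  ultimately show ?thesis using True by blast
next
  case False
  then have "dropWhile (\<lambda>x. letter_of x \<noteq> a) (map Letter u) = []" by auto
  with False show ?thesis by (simp only: light_first_def) simp
qed

lemma first_two_adjacent_imp_mul: "first_two_adjacent a u \<Longrightarrow> a \<in> mul u"
  by (auto simp: first_two_adjacent_def mul_def)

lemma mem_set_of_mem_mul: "a \<in> mul u \<Longrightarrow> a \<in> set u"
  using count_list_0_iff[of u a] by (simp add: mul_def)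

lemma mul_remdups_adj_subset: "mul (remdups_adj u) \<subseteq> mul u"
proof -
  have "count_list (remdups_adj u) a \<le> count_list u a" for a
    by (induction u rule: remdups_adj.induct) auto
  then show ?thesis unfolding mul_def using le_trans by blast
qed

text \<open>The first two occurrences lie in different blocks of equal letters, and each block
  leaves one copy.\<close>

lemma mul_remdups_adj:
  assumes "a \<in> mul u" "\<not> first_two_adjacent a u"
  shows "a \<in> mul (remdups_adj u)"
proof -
  from assms(1) have "a \<in> set u" by (rule mem_set_of_mem_mul)
  then obtain xs ys where u: "u = xs @ a # ys" "a \<notin> set xs"
    by (meson split_list_first)
  have "a \<in> set ys"
    by (rule ccontr) (use u assms(1) in \<open>simp add: mul_def\<close>)
  then obtain b zs where ys: "ys = b # zs" by (cases ys) auto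
  have "a \<noteq> b"
  proof
    assume "a = b"
    with u ys have "u = xs @ [a, a] @ zs" by simp
    with u(2) assms(2) show False unfolding first_two_adjacent_def by blast
  qed
  then have "remdups_adj u = remdups_adj (xs @ [a]) @ remdups_adj ys"
    using remdups_adj_append'[of "xs @ [a]" ys] u ys by simp
  moreover have "count_list (remdups_adj (xs @ [a])) a \<noteq> 0" "count_list (remdups_adj ys) a \<noteq> 0"
    using \<open>a \<in> set ys\<close> by (simp_all add: count_list_0_iff)
  ultimately show ?thesis by (simp add: mul_def)
qed

text \<open>Recovers multiplicity: a multiple letter either has its first two occurrences adjacent,
  which \<open>light_first\<close> transfers to \<open>v\<close>, or is already multiple in the
  common \<open>remdups_adj\<close>.\<close>

lemma light_first_eq_imp_mul_subset:
  assumes "remdups_adj u = remdups_adj v"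
    and "light_first (map Letter u) = light_first (map Letter v)"
  shows "mul u \<subseteq> mul v"
proof
  fix a assume a: "a \<in> mul u"
  have s: "set u = set v" using assms(1) by (metis remdups_adj_set)
  from a have "a \<in> set u" by (rule mem_set_of_mem_mul)
  then have eq: "first_two_adjacent a u \<longleftrightarrow> first_two_adjacent a v"
    using fun_cong[OF assms(2), of a] s by (simp add: light_first_map_Letter)
  show "a \<in> mul v"
  proof (cases "first_two_adjacent a u")
    case True
    then show ?thesis using eq first_two_adjacent_imp_mul by metis
  next
    case False
    then show ?thesis
      using mul_remdups_adj[OF a] mul_remdups_adj_subset[of v] assms(1) by auto
  qed
qed

section \<open>\<open>lambda\<close>, \<open>gamma\<close> and \<open>rho\<close> as equality of
  invariants\<close>

lemma lambda_iff:
  "(u, v) \<in> lambda \<longleftrightarrow> remdups_adj u = remdups_adj v \<and>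
     light_first (map Letter u) = light_first (map Letter v)"
proof (cases "remdups_adj u = remdups_adj v")
  case True
  then have s: "set u = set v" by (metis remdups_adj_set)
  then have l: "light_first (map Letter u) = light_first (map Letter v) \<longleftrightarrow>
      (\<forall>a \<in> set u. first_two_adjacent a u \<longleftrightarrow> first_two_adjacent a v)"
    by (auto simp: fun_eq_iff light_first_map_Letter)
  have "mul u = mul v" if "light_first (map Letter u) = light_first (map Letter v)"
    using light_first_eq_imp_mul_subset True that by (metis subset_antisym)
  \<comment> \<open>\<open>light_first\<close> compares adjacency on all of \<open>set u\<close>,
    \<open>lambda\<close> on \<open>mul u\<close>; outside \<open>mul u = mul v\<close> adjacency
    fails in both words.\<close>
  with True l show ?thesis
    unfolding lambda_def gamma_def tau1_eq
    using first_two_adjacent_imp_mul mem_set_of_mem_mul by fastforce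
qed (simp add: lambda_def gamma_def tau1_eq)

lemma gamma_iff:
  "(u, v) \<in> gamma \<longleftrightarrow> remdups_adj u = remdups_adj v \<and>
     light Gamma (map Letter u) = light Gamma (map Letter v)"
proof (cases "remdups_adj u = remdups_adj v")
  case True
  then have "set u = set v" by (metis remdups_adj_set)
  \<comment> \<open>Within the common letter set, \<open>light Gamma\<close> is the complement of
    \<open>mul\<close>.\<close>
  with True show ?thesis
    unfolding gamma_def tau1_eq
    by (auto simp: fun_eq_iff light_Gamma_map_Letter simp del: light.simps dest: mem_set_of_mem_mul)
qed (simp add: gamma_def tau1_eq)

lemma last_two_adjacent_rev: "last_two_adjacent a u \<longleftrightarrow> first_two_adjacent a (rev u)"
proof
  assume "last_two_adjacent a u"
  then obtain xs ys where "u = xs @ [a, a] @ ys" "a \<notin> set ys"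
    by (auto simp: last_two_adjacent_def)
  then have "rev u = rev ys @ [a, a] @ rev xs" "a \<notin> set (rev ys)" by auto
  then show "first_two_adjacent a (rev u)" unfolding first_two_adjacent_def by blast
next
  assume "first_two_adjacent a (rev u)"
  then obtain xs ys where "rev u = xs @ [a, a] @ ys" "a \<notin> set xs"
    by (auto simp: first_two_adjacent_def)
  then have "u = rev ys @ [a, a] @ rev xs" "a \<notin> set (rev xs)" by (auto simp: rev_swap)
  then show "last_two_adjacent a u" unfolding last_two_adjacent_def by blast
qed

lemma rho_iff:
  "(u, v) \<in> rho \<longleftrightarrow> remdups_adj u = remdups_adj v \<and>
     light Rho (map Letter u) = light Rho (map Letter v)"
proof -
  \<comment> \<open>\<open>remdups_adj\<close> and \<open>mul\<close> are compatible with reversal,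
    which exchanges first and last occurrences.\<close>
  have "(u, v) \<in> rho \<longleftrightarrow> (rev u, rev v) \<in> lambda"
    by (simp add: rho_def lambda_def gamma_def tau1_eq mul_rev last_two_adjacent_rev remdups_adj_rev)
  then show ?thesis
    by (simp add: lambda_iff remdups_adj_rev rev_map fun_eq_iff)
qed

lemma map_letter_of_map_Letter: "map letter_of (map Letter u) = u"
  by (induction u) auto

text \<open>For \<open>Tau1\<close>, \<open>light\<close> is constantly false, so only
  \<open>remdups_adj\<close> is compared.\<close>

lemma cong_rel_eq: "cong_rel t = {(u, v). r t u = r t v}"
  unfolding r_def normal_form_eq_iff map_letter_of_map_Letter
  by (cases t) (auto simp: tau1_eq gamma_iff lambda_iff rho_iff fun_eq_iff simp del: light.simps(2))

section \<open>The first isomorphism theorem and its application\<close>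

lemma quotient_monoid_iso:
  fixes h :: "'b \<Rightarrow> 'c" and M :: "'b monoid" and N :: "'c monoid"
  assumes M: "carrier M = UNIV" and h: "h \<in> hom M N" and surj: "range h = carrier N"
    and T: "T = {(x, y). h x = h y}"
  shows "\<exists>\<phi> \<in> iso (quotient_monoid M T) N.
    \<forall>X \<in> carrier (quotient_monoid M T). \<forall>x \<in> X. \<phi> X = h x"
proof
  let ?Q = "quotient_monoid M T"
  \<comment> \<open>Any choice of representative gives the same value, as \<open>h\<close> is
    constant on the classes of its kernel.\<close>
  define \<phi> where "\<phi> X = h (SOME x. x \<in> X)" for X
  have car: "carrier ?Q = range (\<lambda>x. T `` {x})"
    by (auto simp: quotient_monoid_def M quotient_def)
  have cls: "T `` {x} = {y. h y = h x}" for x by (auto simp: T)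
  have \<phi>_class: "\<phi> (T `` {x}) = h x" for x
    using someI[of "\<lambda>y. y \<in> T `` {x}" x] by (simp add: cls \<phi>_def)
  have hm: "h (x \<otimes>\<^bsub>M\<^esub> y) = h x \<otimes>\<^bsub>N\<^esub> h y" for x y
    using h by (auto simp: hom_def M)
  \<comment> \<open>All products of representatives lie in one class, so the union defining the
    product is that single class.\<close>
  have mult: "T `` {x} \<otimes>\<^bsub>?Q\<^esub> T `` {y} = T `` {x \<otimes>\<^bsub>M\<^esub> y}" for x y
    by (auto simp: quotient_monoid_def cls hm)
  show "\<forall>X \<in> carrier ?Q. \<forall>x \<in> X. \<phi> X = h x"
  proof (intro ballI)
    fix X x
    assume "X \<in> carrier ?Q" "x \<in> X"
    then obtain y where "X = T `` {y}" "x \<in> T `` {y}" by (auto simp: car)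
    then show "\<phi> X = h x" using \<phi>_class[of y] by (simp add: cls)
  qed
  show "\<phi> \<in> iso ?Q N"
  proof (rule isoI)
    show "\<phi> \<in> hom ?Q N"
      using surj by (auto simp: hom_def car \<phi>_class mult hm)
    show "bij_betw \<phi> (carrier ?Q) (carrier N)"
    proof (rule bij_betw_imageI)
      show "inj_on \<phi> (carrier ?Q)"
      proof (rule inj_onI)
        fix X Y
        assume "X \<in> carrier ?Q" "Y \<in> carrier ?Q" and eq: "\<phi> X = \<phi> Y"
        then obtain x y where XY: "X = T `` {x}" "Y = T `` {y}" unfolding car by blast
        with eq have "h x = h y" by (simp only: \<phi>_class)
        then show "X = Y" by (simp only: XY cls)
      qed
      show "\<phi> ` carrier ?Q = carrier N"
        by (simp only: car image_image \<phi>_class surj)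
    qed
  qed
qed

theorem proposition8p2:
  fixes t :: cong_name
  assumes "countable (UNIV :: 'a set)" and "infinite (UNIV :: 'a set)"
  shows
    "(r t \<in> hom (free_monoid :: 'a list monoid) (reduced_monoid t) \<and>
      r t \<one>\<^bsub>(free_monoid :: 'a list monoid)\<^esub> = \<one>\<^bsub>reduced_monoid t\<^esub> \<and>
      cong_rel t = {(u :: 'a list, v). r t u = r t v}) \<and>
     (\<exists>\<phi> \<in> iso (quotient_monoid (free_monoid :: 'a list monoid) (cong_rel t)) (reduced_monoid t).
        \<forall>U \<in> carrier (quotient_monoid free_monoid (cong_rel t)). \<forall>u \<in> U. \<phi> U = r t u)"
proof -
  have hom: "r t \<in> hom (free_monoid :: 'a list monoid) (reduced_monoid t)"
    using range_r[of t] by (auto simp: hom_def free_monoid_def reduced_monoid_def r_append)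
  moreover have "r t \<one>\<^bsub>(free_monoid :: 'a list monoid)\<^esub> = \<one>\<^bsub>reduced_monoid t\<^esub>"
    by (simp add: free_monoid_def reduced_monoid_def r_Nil)
  moreover have "\<exists>\<phi> \<in> iso (quotient_monoid (free_monoid :: 'a list monoid) (cong_rel t)) (reduced_monoid t).
        \<forall>U \<in> carrier (quotient_monoid free_monoid (cong_rel t)). \<forall>u \<in> U. \<phi> U = r t u"
    \<comment> \<open>\<open>cong_rel_eq\<close> identifies the congruence with the kernel of
      \<open>r t\<close>; surjectivity is \<open>range_r\<close>.\<close>
    by (rule quotient_monoid_iso[OF _ hom _ cong_rel_eq])
       (simp_all add: free_monoid_def reduced_monoid_def range_r)
  ultimately show ?thesis using cong_rel_eq[of t] by blast
qed

end
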